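(* Double helices exist for all orders $n$.
   Context: All strings are over the alphabet $\{0,1\}$. A DeBruijn string of order $n$ is a binary string of minimal length (namely $2^n+n-1$) that contains every binary string of length $n$ as a (contiguous) substring. The DeBruijn graph $\mathcal{B}^n$ is the directed graph whose vertices are the binary strings of length $n$, with an edge from $x\rho$ (with $x$ a digit, $|\rho|=n-1$) to each of $\rho0$ and $\rho1$, and no other edges. A DeBruijn string $X$ of order $n$ begins and ends with the same string of length $n-1$, so the path visiting in order its successive substrings of length $n$ closes up, by the edge from its last vertex to its first, to a Hamiltonian circuit of $\mathcal{B}^n$. $X$ is called a double helix of order $n$ if the graph obtained from $\mathcal{B}^n$ by removing the edges of this circuit has exactly 3 connected components (described as the minimum number possible), including the loop from the all-zero string of length $n$ to itself and the loop from the all-one string of length $n$ to itself.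
   Formalization: Stated for orders n ≥ 2 only: for n = 1 the DeBruijn strings are 01 and 10, and removing the circuit leaves just the two loops (2 components, not 3); for n = 0 the graph has a single vertex, so 3 components are impossible. *)

theory Defs
  imports "HOL-Library.Sublist" "Graph_Theory.Digraph_Component"
begin

(* The digits 0 and 1 are False and True. *)
type_synonym binary_string = "bool list"

definition contains_all_strings :: "nat \<Rightarrow> binary_string \<Rightarrow> bool" where
  "contains_all_strings n X \<longleftrightarrow> (\<forall>w :: binary_string. length w = n \<longrightarrow> sublist w X)"

(* Library "sublist" means contiguous substring (as opposed to "subseq"). *)
definition de_bruijn_string :: "nat \<Rightarrow> binary_string \<Rightarrow> bool" where
  "de_bruijn_string n X \<longleftrightarrow> is_arg_min length (contains_all_strings n) X"

definition de_bruijn_graph :: "nat \<Rightarrow> binary_string pair_pre_digraph" where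
  "de_bruijn_graph n =
     \<lparr> pverts = {v. length v = n},
       parcs = {(x # r, r @ [y]) | x r y. Suc (length r) = n} \<rparr>"

definition windows :: "nat \<Rightarrow> binary_string \<Rightarrow> binary_string list" where
  "windows n X = map (\<lambda>i. take n (drop i X)) [0..<Suc (length X) - n]"

(* rotate1 supplies the closing arc from the last window to the first. *)
definition circuit_arcs :: "nat \<Rightarrow> binary_string \<Rightarrow> (binary_string \<times> binary_string) set" where
  "circuit_arcs n X = set (zip (windows n X) (rotate1 (windows n X)))"

definition remaining_graph :: "nat \<Rightarrow> binary_string \<Rightarrow> binary_string pair_pre_digraph" where
  "remaining_graph n X =
     \<lparr> pverts = pverts (de_bruijn_graph n),
       parcs = parcs (de_bruijn_graph n) - circuit_arcs n X \<rparr>"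

(* Library "connected" ignores the direction of the arcs. *)
definition components :: "('a, 'b) pre_digraph \<Rightarrow> ('a, 'b) pre_digraph set" where
  "components G = {H. pre_digraph.max_subgraph G connected H}"

definition loop_graph :: "'a \<Rightarrow> 'a pair_pre_digraph" where
  "loop_graph v = \<lparr> pverts = {v}, parcs = {(v, v)} \<rparr>"

definition double_helix :: "nat \<Rightarrow> binary_string \<Rightarrow> bool" where
  "double_helix n X \<longleftrightarrow>
     de_bruijn_string n X \<and>
     card (components (with_proj (remaining_graph n X))) = 3 \<and>
     with_proj (loop_graph (replicate n False)) \<in> components (with_proj (remaining_graph n X)) \<and>
     with_proj (loop_graph (replicate n True)) \<in> components (with_proj (remaining_graph n X))"

end

(* A Hamiltonian circuit of the de Bruijn graph is given by a successor map r with x in front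
   mapped to r followed by (x xor h r); removing its arcs leaves exactly the successor map of
   the complementary feedback "not h". So one wants h with a single cycle such that "not h" has
   the two loops and one further cycle, and such h is built by induction on n. The
   2-to-1 homomorphism from order n + 1 to order n taking the xor of adjacent digits (Lempel)
   lifts h to a feedback of order n + 1, compatibly with negation. A cycle lifts to two
   complementary cycles or to one cycle of twice the length, according to the parity of its
   number of words starting with 1. Hence the circuit (2^(n-1) such words) lifts to two cycles;
   on the other side the long cycle (2^(n-1) - 1 such words) lifts to one cycle, the loop at
   1...1 lifts to the 2-cycle of alternating words, and the loop at 0...0 to the two new loops.
   Negating the lifted feedback at the single word 1010... joins the two cycles on the first
   side and joins the 2-cycle to the long cycle on the other. *)

theory Submission
  imports Defs "HOL-Combinatorics.Transposition"
begin

section \<open>Maps with a single cycle\<close>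

text \<open>With \<open>k = 0\<close> allowed, reachability alone is trivial on a singleton; closure
  under \<open>f\<close> is what makes it a loop.\<close>

definition single_cycle :: "('a \<Rightarrow> 'a) \<Rightarrow> 'a set \<Rightarrow> bool" where
  "single_cycle f S \<longleftrightarrow> f ` S \<subseteq> S \<and> (\<forall>u\<in>S. \<forall>w\<in>S. \<exists>k. (f ^^ k) u = w)"

lemma single_cycle_reach:
  assumes "single_cycle f S" "u \<in> S" "w \<in> S"
  obtains k where "(f ^^ k) u = w"
  using assms unfolding single_cycle_def by blast

lemma funpow_in_set: "f ` S \<subseteq> S \<Longrightarrow> u \<in> S \<Longrightarrow> (f ^^ k) u \<in> S"
  by (induction k) auto

lemma single_cycle_funpow_in: "single_cycle f S \<Longrightarrow> u \<in> S \<Longrightarrow> (f ^^ k) u \<in> S"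
  by (simp add: single_cycle_def funpow_in_set)

text \<open>Since \<open>f u\<close> leads back to \<open>u\<close>, there is a least period
  \<open>p\<close>. Minimality makes the first \<open>p\<close> iterates distinct, and reducing
  exponents modulo \<open>p\<close> shows that they exhaust \<open>S\<close>; so
  \<open>p = card S\<close>.\<close>

lemma single_cycle_period:
  assumes f: "single_cycle f S" and u: "u \<in> S"
  shows "bij_betw (\<lambda>i. (f ^^ i) u) {..<card S} S" "(f ^^ card S) u = u"
proof -
  have "f u \<in> S"
    using f u by (auto simp: single_cycle_def)
  with f obtain j where "(f ^^ j) (f u) = u"
    using u by (rule single_cycle_reach)
  then have ex: "\<exists>p. p > 0 \<and> (f ^^ p) u = u"
    by (intro exI[of _ "Suc j"]) (simp add: funpow_swap1)
  define p where "p = (LEAST p. p > 0 \<and> (f ^^ p) u = u)"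
  have p: "p > 0" "(f ^^ p) u = u"
    using LeastI_ex[OF ex] unfolding p_def by auto
  have least: "p \<le> q" if "q > 0" "(f ^^ q) u = u" for q
    unfolding p_def using that by (intro Least_le) auto
  have "(f ^^ i) u \<noteq> (f ^^ j) u" if "i < j" "j < p" for i j
  proof
    assume "(f ^^ i) u = (f ^^ j) u"
    then have "(f ^^ (p - j)) ((f ^^ i) u) = (f ^^ (p - j)) ((f ^^ j) u)"
      by simp
    then have "(f ^^ (p - j + i)) u = (f ^^ (p - j + j)) u"
      by (simp only: funpow_add o_apply)
    then have "(f ^^ (p - j + i)) u = u"
      using that p by simp
    from least[OF _ this] that show False
      by linarith
  qed
  then have inj: "inj_on (\<lambda>i. (f ^^ i) u) {..<p}"
    by (metis (no_types, lifting) inj_onI lessThan_iff linorder_neq_iff)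
  have im: "(\<lambda>i. (f ^^ i) u) ` {..<p} = S"
  proof (intro equalityI subsetI)
    fix w assume "w \<in> S"
    with f u obtain k where "(f ^^ k) u = w"
      by (rule single_cycle_reach)
    then have "(f ^^ (k mod p)) u = w"
      using funpow_mod_eq[OF p(2)] by metis
    then show "w \<in> (\<lambda>i. (f ^^ i) u) ` {..<p}"
      using p(1) by (metis imageI lessThan_iff mod_less_divisor)
  qed (auto intro: single_cycle_funpow_in[OF f u])
  have "card S = p"
    using card_image[OF inj] im by simp
  with inj im p show "bij_betw (\<lambda>i. (f ^^ i) u) {..<card S} S" "(f ^^ card S) u = u"
    by (auto simp: bij_betw_def)
qed

lemma single_cycle_dvd:
  assumes f: "single_cycle f S" and u: "u \<in> S" and "finite S" and j: "(f ^^ j) u = u"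
  shows "card S dvd j"
proof -
  have "card S > 0"
    using assms by (auto simp: card_gt_0_iff)
  moreover have "(f ^^ (j mod card S)) u = (f ^^ 0) u"
    using funpow_mod_eq[OF single_cycle_period(2)[OF f u]] j by simp
  ultimately have "j mod card S = 0"
    using inj_onD[OF bij_betw_imp_inj_on[OF single_cycle_period(1)[OF f u]]] by simp
  then show ?thesis
    by auto
qed

section \<open>Opening and splicing cycles\<close>

lemma funpow_agree:
  assumes "(f ^^ k) x = y" "\<And>i. i < k \<Longrightarrow> g ((f ^^ i) x) = f ((f ^^ i) x)"
  shows "(g ^^ k) x = y"
  using assms by (induction k arbitrary: y) auto

text \<open>Redirecting \<open>f\<close> at \<open>a\<close> opens the cycle into a path from
  \<open>f a\<close> to \<open>a\<close>. A shortest \<open>f\<close>-path to \<open>a\<close>, or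
  from \<open>f a\<close>, does not use the arc out of \<open>a\<close>, so \<open>g\<close> follows
  it.\<close>

lemma single_cycle_swap_aux:
  assumes A: "single_cycle f A" "a \<in> A" and g: "\<And>x. x \<in> A \<Longrightarrow> x \<noteq> a \<Longrightarrow> g x = f x"
    and x: "x \<in> A"
  shows "\<exists>k. (g ^^ k) x = a" "\<exists>k. (g ^^ k) (f a) = x"
proof -
  have *: "\<exists>k. (f ^^ k) x = a"
    using A x by (auto simp: single_cycle_def)
  define k where "k = (LEAST k. (f ^^ k) x = a)"
  have k: "(f ^^ k) x = a" "\<And>i. i < k \<Longrightarrow> (f ^^ i) x \<noteq> a"
    using LeastI_ex[OF *] not_less_Least[of _ "\<lambda>k. (f ^^ k) x = a"] unfolding k_def by auto
  have "(g ^^ k) x = a"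
    using g k(2) single_cycle_funpow_in[OF A(1) x] by (intro funpow_agree[OF k(1)]) blast
  then show "\<exists>k. (g ^^ k) x = a" ..
next
  have fa: "f a \<in> A"
    using A by (auto simp: single_cycle_def)
  have *: "\<exists>k. (f ^^ k) (f a) = x"
    using A(1) fa x by (auto simp: single_cycle_def)
  define k where "k = (LEAST k. (f ^^ k) (f a) = x)"
  have k: "(f ^^ k) (f a) = x" "\<And>i. i < k \<Longrightarrow> (f ^^ i) (f a) \<noteq> x"
    using LeastI_ex[OF *] not_less_Least[of _ "\<lambda>k. (f ^^ k) (f a) = x"] unfolding k_def by auto
  have "(f ^^ i) (f a) \<noteq> a" if "i < k" for i
  proof
    assume "(f ^^ i) (f a) = a"
    then have "(f ^^ Suc i) (f a) = f a"
      by simp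
    moreover have "k = (k - Suc i) + Suc i"
      using that by simp
    ultimately have "(f ^^ (k - Suc i)) (f a) = x"
      using k(1) by (metis funpow_add o_apply)
    then show False
      using k(2)[of "k - Suc i"] that by simp
  qed
  then have "(g ^^ k) (f a) = x"
    using g single_cycle_funpow_in[OF A(1) fa] by (intro funpow_agree[OF k(1)]) blast
  then show "\<exists>k. (g ^^ k) (f a) = x" ..
qed

text \<open>Exchanging the successors of \<open>a\<close> and \<open>b\<close> splices the opened
  cycles: the path ending in \<open>a\<close> continues at \<open>f b\<close>, the one ending in
  \<open>b\<close> at \<open>f a\<close>.\<close>

lemma single_cycle_join:
  assumes A: "single_cycle f A" "a \<in> A" and B: "single_cycle f B" "b \<in> B"
    and disj: "A \<inter> B = {}"
    and g: "\<And>x. x \<in> A \<union> B \<Longrightarrow> g x = f (transpose a b x)"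
  shows "single_cycle g (A \<union> B)"
proof -
  define R where "R x y \<longleftrightarrow> (\<exists>k. (g ^^ k) x = y)" for x y
  have trans: "R x z" if "R x y" "R y z" for x y z
    using that unfolding R_def by (metis funpow_add o_apply)
  have step: "R x (g x)" for x
    unfolding R_def by (intro exI[of _ 1]) simp
  have ab: "g a = f b" "g b = f a"
    using g A B by auto
  have gA: "g x = f x" if "x \<in> A" "x \<noteq> a" for x
    using that g[of x] B disj by (metis UnI1 IntI empty_iff transpose_apply_other)
  have gB: "g x = f x" if "x \<in> B" "x \<noteq> b" for x
    using that g[of x] A disj by (metis UnI2 IntI empty_iff transpose_apply_other)
  have "R x a" "R (f a) x" if "x \<in> A" for x
    using single_cycle_swap_aux[OF A gA that] by (auto simp: R_def)
  moreover have "R x b" "R (f b) x" if "x \<in> B" for x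
    using single_cycle_swap_aux[OF B gB that] by (auto simp: R_def)
  ultimately have "R x y" if "x \<in> A \<union> B" "y \<in> A \<union> B" for x y
    using that ab step trans A(2) B(2) by (metis Un_iff)
  moreover have "g x \<in> A \<union> B" if "x \<in> A \<union> B" for x
    using that gA gB ab A B by (cases "x = a"; cases "x = b") (auto simp: single_cycle_def)
  ultimately show ?thesis
    unfolding single_cycle_def R_def by blast
qed


section \<open>Feedback shift registers and their lifts\<close>

text \<open>A nonsingular feedback shift register: \<open>\<noteq>\<close> on booleans is xor, and
  xoring in the outgoing digit keeps the step injective on nonempty words for every
  \<open>h\<close>.\<close>

definition shift_step :: "(bool list \<Rightarrow> bool) \<Rightarrow> bool list \<Rightarrow> bool list" where
  "shift_step h w = tl w @ [hd w \<noteq> h (tl w)]"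

fun xor_adjacent :: "bool list \<Rightarrow> bool list" where
  "xor_adjacent (a # b # w) = (a \<noteq> b) # xor_adjacent (b # w)"
| "xor_adjacent _ = []"

text \<open>Chosen so that \<open>xor_adjacent\<close> semiconjugates the lifted register to the original one.\<close>
definition lift_feedback :: "(bool list \<Rightarrow> bool) \<Rightarrow> bool list \<Rightarrow> bool" where
  "lift_feedback h r = (hd r \<noteq> (last r \<noteq> h (xor_adjacent r)))"

fun alternating :: "nat \<Rightarrow> bool \<Rightarrow> bool list" where
  "alternating 0 b = []"
| "alternating (Suc n) b = b # alternating n (\<not> b)"

section \<open>Lempel's homomorphism and its compatibility with the lift\<close>

lemma length_shift_step: "w \<noteq> [] \<Longrightarrow> length (shift_step h w) = length w"
  by (simp add: shift_step_def)

lemma length_xor_adjacent [simp]: "length (xor_adjacent w) = length w - 1"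
  by (induction w rule: xor_adjacent.induct) auto

lemma xor_adjacent_snoc:
  "r \<noteq> [] \<Longrightarrow> xor_adjacent (r @ [c]) = xor_adjacent r @ [last r \<noteq> c]"
  by (induction r rule: xor_adjacent.induct) auto

lemma xor_adjacent_map_Not [simp]: "xor_adjacent (map Not w) = xor_adjacent w"
  by (induction w rule: xor_adjacent.induct) auto

lemma xor_adjacent_inj:
  "length u = length w \<Longrightarrow> xor_adjacent u = xor_adjacent w \<Longrightarrow> hd u = hd w \<Longrightarrow> u = w"
proof (induction u arbitrary: w rule: xor_adjacent.induct)
  case (1 a b u)
  then obtain a' b' w' where "w = a' # b' # w'"
    by (metis length_Suc_conv)
  with "1.prems" "1.IH"[of "b' # w'"] show ?case by auto
next
  case ("2_2" a)
  then show ?case by (cases w) auto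
qed auto

lemma xor_adjacent_eq_cases:
  assumes "length u = length w" "xor_adjacent u = xor_adjacent w"
  shows "u = w \<or> u = map Not w"
proof (cases "hd u = hd w \<or> w = []")
  case False
  then have "hd u = hd (map Not w)"
    by (cases w) auto
  then show ?thesis
    using xor_adjacent_inj[of u "map Not w"] assms by simp
next
  case True
  then show ?thesis
    using xor_adjacent_inj[OF assms] assms(1) by auto
qed

text \<open>The terms \<open>hd r\<close> and \<open>last r\<close> of the lifted feedback turn the
  outgoing and the incoming digit into adjacent differences, which leaves the step of
  \<open>h\<close>.\<close>

lemma xor_adjacent_shift_step:
  assumes "length w \<ge> 2"
  shows "xor_adjacent (shift_step (lift_feedback h) w) = shift_step h (xor_adjacent w)"
proof -
  from assms obtain a b r where w: "w = a # b # r"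
    by (metis One_nat_def Suc_1 Suc_le_length_iff)
  have "xor_adjacent ((b # r) @ [c]) = xor_adjacent (b # r) @ [last (b # r) \<noteq> c]" for c
    by (rule xor_adjacent_snoc) simp
  then show ?thesis
    unfolding w by (auto simp: shift_step_def lift_feedback_def)
qed

text \<open>Complementing flips \<open>hd r\<close> and \<open>last r\<close> together, so the
  lifted feedback is unchanged.\<close>

lemma shift_step_map_Not:
  assumes "length w \<ge> 2"
  shows "shift_step (lift_feedback h) (map Not w) = map Not (shift_step (lift_feedback h) w)"
proof -
  from assms obtain a b r where w: "w = a # b # r"
    by (metis One_nat_def Suc_1 Suc_le_length_iff)
  have "last (map Not (b # r)) = (\<not> last (b # r))"
    by (rule last_map) simp
  then show ?thesis
    using xor_adjacent_map_Not[of "b # r"] unfolding w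
    by (auto simp: shift_step_def lift_feedback_def)
qed

lemma lift_feedback_Not: "lift_feedback (\<lambda>r. \<not> h r) = (\<lambda>r. \<not> lift_feedback h r)"
  by (auto simp: lift_feedback_def)

lemma xor_adjacent_alternating: "xor_adjacent (alternating (Suc n) b) = replicate n True"
proof (induction n arbitrary: b)
  case (Suc n)
  show ?case using Suc[of "\<not> b"] by simp
qed simp

lemma xor_adjacent_replicate: "xor_adjacent (replicate (Suc n) b) = replicate n False"
  by (induction n) auto

lemma length_alternating [simp]: "length (alternating n b) = n"
  by (induction n arbitrary: b) auto

lemma finite_bool_lists: "finite {w :: bool list. length w = n}"
  using finite_lists_length_eq[of "UNIV :: bool set" n] by simp

text \<open>The heads of the iterates of \<open>u\<close> change precisely when the head of \<open>xor_adjacent u\<close>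
  is \<open>True\<close>; so traversing a cycle \<open>S\<close> once returns to \<open>u\<close> or to its complement, according to
  the parity of the number of words in \<open>S\<close> starting with \<open>True\<close>.\<close>

locale lifted_cycle =
  fixes h :: "bool list \<Rightarrow> bool" and n :: nat and S :: "bool list set"
  assumes n: "n \<ge> 1" and S: "\<And>w. w \<in> S \<Longrightarrow> length w = n"
    and cyc: "single_cycle (shift_step h) S"
begin

abbreviation "F \<equiv> shift_step (lift_feedback h)"
definition "T = {w. length w = Suc n \<and> xor_adjacent w \<in> S}"

lemma finite_S: "finite S"
  using S by (auto intro: finite_subset[OF _ finite_bool_lists[of n]])

lemma xor_F: "w \<in> T \<Longrightarrow> xor_adjacent (F w) = shift_step h (xor_adjacent w)"
  using n by (intro xor_adjacent_shift_step) (auto simp: T_def)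

lemma F_in_T: "w \<in> T \<Longrightarrow> F w \<in> T"
  using xor_F[of w] cyc length_shift_step[of w] by (cases w) (auto simp: T_def single_cycle_def)

lemma hd_map_Not: "w \<in> T \<Longrightarrow> hd (map Not w) = (\<not> hd w)"
  by (cases w) (auto simp: T_def)

lemma funpow_F_in_T: "w \<in> T \<Longrightarrow> (F ^^ k) w \<in> T"
  using F_in_T by (intro funpow_in_set) auto

lemma map_Not_in_T: "w \<in> T \<Longrightarrow> map Not w \<in> T"
  by (simp add: T_def)

lemma xor_funpow_F: "w \<in> T \<Longrightarrow> xor_adjacent ((F ^^ k) w) = (shift_step h ^^ k) (xor_adjacent w)"
  by (induction k) (auto simp: xor_F funpow_F_in_T)

lemma funpow_F_map_Not:
  assumes "w \<in> T" shows "(F ^^ k) (map Not w) = map Not ((F ^^ k) w)"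
proof (induction k)
  case (Suc k)
  have "(F ^^ k) w \<in> T"
    using assms by (rule funpow_F_in_T)
  then have "length ((F ^^ k) w) \<ge> 2"
    using n by (simp add: T_def)
  with Suc show ?case
    by (simp add: shift_step_map_Not)
qed auto

lemma eq_or_map_Not:
  assumes "u \<in> T" "w \<in> T" "xor_adjacent u = xor_adjacent w"
  shows "u = w \<or> u = map Not w"
  using assms by (intro xor_adjacent_eq_cases) (auto simp: T_def)

lemma hd_F: "w \<in> T \<Longrightarrow> hd (F w) = (hd w \<noteq> hd (xor_adjacent w))"
  using n by (cases w rule: xor_adjacent.cases) (auto simp: T_def shift_step_def)

lemma hd_funpow_F:
  assumes "w \<in> T"
  shows "hd ((F ^^ k) w) = (hd w \<noteq> odd (card {i\<in>{..<k}. hd ((shift_step h ^^ i) (xor_adjacent w))}))"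
proof (induction k)
  case (Suc k)
  let ?P = "\<lambda>i. hd ((shift_step h ^^ i) (xor_adjacent w))"
  have "{i\<in>{..<Suc k}. ?P i} = (if ?P k then insert k {i\<in>{..<k}. ?P i} else {i\<in>{..<k}. ?P i})"
    by (auto simp: less_Suc_eq)
  then have "odd (card {i\<in>{..<Suc k}. ?P i}) = (odd (card {i\<in>{..<k}. ?P i}) \<noteq> ?P k)"
    by simp
  moreover have "hd ((F ^^ Suc k) w) = (hd ((F ^^ k) w) \<noteq> ?P k)"
    using hd_F[OF funpow_F_in_T[OF assms]] xor_funpow_F[OF assms] by simp
  ultimately show ?case
    using Suc by auto
qed auto

lemma funpow_F_period:
  assumes "w \<in> T"
  shows "(F ^^ card S) w = (if odd (card {v\<in>S. hd v}) then map Not w else w)"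
proof -
  let ?x = "xor_adjacent w"
  have x: "?x \<in> S"
    using assms by (simp add: T_def)
  note per = single_cycle_period[OF cyc x]
  \<comment> \<open>The orbit bijection turns a count of steps into a count of words, independent of
    the starting word.\<close>
  have "bij_betw (\<lambda>i. (shift_step h ^^ i) ?x) {i\<in>{..<card S}. hd ((shift_step h ^^ i) ?x)} {v\<in>S. hd v}"
    using per(1) by (auto simp: bij_betw_def inj_on_def image_iff)
  then have "card {i\<in>{..<card S}. hd ((shift_step h ^^ i) ?x)} = card {v\<in>S. hd v}"
    by (rule bij_betw_same_card)
  then have hd: "hd ((F ^^ card S) w) = (hd w \<noteq> odd (card {v\<in>S. hd v}))"
    using hd_funpow_F[OF assms, of "card S"] by simp
  have "xor_adjacent ((F ^^ card S) w) = ?x"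
    using xor_funpow_F[OF assms] per(2) by simp
  then have "(F ^^ card S) w = w \<or> (F ^^ card S) w = map Not w"
    using assms funpow_F_in_T eq_or_map_Not by blast
  moreover have "hd (map Not w) = (\<not> hd w)"
    using assms by (rule hd_map_Not)
  ultimately show ?thesis
    using hd by auto
qed

lemma reach_or_map_Not:
  assumes "u \<in> T" "w \<in> T"
  obtains k where "(F ^^ k) u = w \<or> (F ^^ k) u = map Not w"
proof -
  have "xor_adjacent u \<in> S" "xor_adjacent w \<in> S"
    using assms by (auto simp: T_def)
  with cyc obtain k where "(shift_step h ^^ k) (xor_adjacent u) = xor_adjacent w"
    by (rule single_cycle_reach)
  then have "xor_adjacent ((F ^^ k) u) = xor_adjacent w"
    using xor_funpow_F[OF assms(1)] by simp
  then show thesis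
    using assms funpow_F_in_T eq_or_map_Not that by blast
qed

text \<open>Whichever of \<open>w\<close> and its complement is reached first, another
  \<open>card S\<close> steps lead to the other one.\<close>

lemma single_cycle_lift:
  assumes "odd (card {v\<in>S. hd v})"
  shows "single_cycle F T"
  unfolding single_cycle_def
proof (intro conjI ballI)
  fix u w assume u: "u \<in> T" and w: "w \<in> T"
  then obtain k where k: "(F ^^ k) u = w \<or> (F ^^ k) u = map Not w"
    by (rule reach_or_map_Not)
  have "(F ^^ card S) (map Not w) = w"
    using funpow_F_period[OF map_Not_in_T[OF w]] assms by (simp add: comp_def)
  with k show "\<exists>k. (F ^^ k) u = w"
    by (metis funpow_add o_apply)
qed (use F_in_T in auto)

text \<open>One round restores every word, so the orbit of \<open>u\<close> meets each fibre once,
  and complementation carries it to the rest of \<open>T\<close>.\<close>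

lemma even_lift:
  assumes ev: "even (card {v\<in>S. hd v})" and u: "u \<in> T"
  defines "A \<equiv> {w. \<exists>k. (F ^^ k) u = w}"
  shows "single_cycle F A" "single_cycle F (map Not ` A)"
    "A \<inter> map Not ` A = {}" "A \<union> map Not ` A = T"
proof -
  have per: "(F ^^ (card S * q)) w = w" if "w \<in> T" for q w
    using funpow_F_period[OF that] ev by (induction q) (auto simp: funpow_add)
  have S0: "card S > 0"
    using u finite_S by (auto simp: card_gt_0_iff T_def)
  have AT: "A \<subseteq> T"
    using funpow_F_in_T[OF u] by (auto simp: A_def)
  \<comment> \<open>\<open>card S * j\<close> is a whole number of rounds and at least
    \<open>j\<close>, so the remaining steps lead from \<open>w\<close> back to
    \<open>u\<close>.\<close>
  have return: "\<exists>k. (F ^^ k) w = u" if "(F ^^ j) u = w" for j w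
  proof -
    have "card S * j \<ge> j"
      using S0 by simp
    then have "card S * j = (card S * j - j) + j"
      by simp
    then have "(F ^^ (card S * j - j)) w = (F ^^ (card S * j)) u"
      using that by (metis funpow_add o_apply)
    then show ?thesis
      using per[OF u] by auto
  qed
  show cA: "single_cycle F A"
    unfolding single_cycle_def
  proof (intro conjI ballI)
    show "F ` A \<subseteq> A"
    proof
      fix v assume "v \<in> F ` A"
      then obtain k where "v = F ((F ^^ k) u)"
        by (auto simp: A_def)
      then have "(F ^^ Suc k) u = v"
        by simp
      then show "v \<in> A"
        unfolding A_def by blast
    qed
    fix v w assume "v \<in> A" "w \<in> A"
    then obtain j k where "(F ^^ j) v = u" "(F ^^ k) u = w"
      using return unfolding A_def by blast
    then show "\<exists>k. (F ^^ k) v = w"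
      by (metis funpow_add o_apply)
  qed
  show "single_cycle F (map Not ` A)"
    unfolding single_cycle_def
  proof (intro conjI ballI)
    have "F (map Not w) = map Not (F w)" if "w \<in> A" for w
      using funpow_F_map_Not[of w 1] that AT by auto
    then show "F ` map Not ` A \<subseteq> map Not ` A"
      using cA by (auto simp: single_cycle_def)
    fix v w assume "v \<in> map Not ` A" "w \<in> map Not ` A"
    then obtain v' w' where vw: "v = map Not v'" "w = map Not w'" "v' \<in> A" "w' \<in> A"
      by blast
    then obtain k where "(F ^^ k) v' = w'"
      using cA by (blast elim: single_cycle_reach)
    then have "(F ^^ k) v = w"
      using funpow_F_map_Not vw AT by blast
    then show "\<exists>k. (F ^^ k) v = w" ..
  qed
  show "A \<inter> map Not ` A = {}"
  proof -
    \<comment> \<open>A word and its complement have the same projection, so a path between them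
      takes a multiple of \<open>card S\<close> steps; but that restores \<open>w\<close>.\<close>
    have "map Not w \<notin> A" if wA: "w \<in> A" for w
    proof
      assume "map Not w \<in> A"
      with cA wA obtain j where j: "(F ^^ j) w = map Not w"
        by (rule single_cycle_reach)
      have w: "w \<in> T"
        using wA AT by auto
      then have x: "xor_adjacent w \<in> S"
        by (simp add: T_def)
      have "(shift_step h ^^ j) (xor_adjacent w) = xor_adjacent w"
        using xor_funpow_F[OF w, of j] j by simp
      then have "card S dvd j"
        by (rule single_cycle_dvd[OF cyc x finite_S])
      then have "map Not w = w"
        using j per[OF w] by auto
      moreover have "hd (map Not w) = (\<not> hd w)"
        using w by (rule hd_map_Not)
      ultimately show False
        by simp
    qed
    then show ?thesis
      by auto
  qed
  show "A \<union> map Not ` A = T"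
  proof (intro equalityI subsetI)
    fix w assume "w \<in> T"
    with u obtain k where "(F ^^ k) u = w \<or> (F ^^ k) u = map Not w"
      by (rule reach_or_map_Not)
    then have "w \<in> A \<or> map Not w \<in> A"
      by (auto simp: A_def)
    moreover have "w = map Not (map Not w)"
      by (simp add: comp_def)
    ultimately show "w \<in> A \<union> map Not ` A"
      by blast
  qed (use AT map_Not_in_T in auto)
qed

end


section \<open>Two complementary cycles in the de Bruijn graph\<close>

definition nonconstant_words :: "nat \<Rightarrow> bool list set" where
  "nonconstant_words n = {w. length w = n} - {replicate n False, replicate n True}"

lemma card_bool_lists: "card {w :: bool list. length w = n} = 2 ^ n"
  using card_lists_length_eq[of "UNIV :: bool set" n] by simp

lemma card_hd_bool_lists: "card {v \<in> {w. length w = Suc m}. hd v} = 2 ^ m"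
proof -
  have "{v \<in> {w. length w = Suc m}. hd v} = (#) True ` {w. length w = m}"
    by (auto simp: length_Suc_conv)
  then show ?thesis
    by (simp add: card_image card_bool_lists)
qed

lemma odd_hd_nonconstant:
  assumes "n \<ge> 2" shows "odd (card {v \<in> nonconstant_words n. hd v})"
proof -
  obtain m where n: "n = Suc m" "m \<ge> 1"
    using assms by (cases n) auto
  have "{v \<in> nonconstant_words n. hd v} = {v \<in> {w. length w = n}. hd v} - {replicate n True}"
    by (auto simp: nonconstant_words_def n)
  then have "card {v \<in> nonconstant_words n. hd v} = 2 ^ m - 1"
    using card_hd_bool_lists[of m] by (simp add: n card_Diff_singleton)
  then show ?thesis
    using n by simp
qed

text \<open>Only \<open>False # v\<close> and \<open>True # v\<close> have tail \<open>v\<close>,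
  and negating the feedback there exchanges their successors, as \<open>single_cycle_join\<close>
  requires.\<close>

lemma shift_step_toggle:
  assumes "x \<noteq> []"
  shows "shift_step (\<lambda>r. k r \<noteq> (r = v)) x = shift_step k (transpose (False # v) (True # v) x)"
  using assms by (cases x) (auto simp: shift_step_def transpose_def)

lemma funpow_fixed: "f x = x \<Longrightarrow> (f ^^ k) x = x"
  by (induction k) auto

text \<open>Otherwise the constant word of length \<open>Suc m\<close> would be a fixed point and
  could not reach the opposite constant word.\<close>

lemma feedback_constant:
  assumes "single_cycle (shift_step h) {w. length w = Suc m}"
  shows "h (replicate m b)"
proof (rule ccontr)
  assume "\<not> h (replicate m b)"
  then have "shift_step h (replicate (Suc m) b) = replicate (Suc m) b"
    by (simp add: shift_step_def replicate_append_same del: replicate_Suc) (simp add: replicate_append_same)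
  then have fixed: "(shift_step h ^^ k) (replicate (Suc m) b) = replicate (Suc m) b" for k
    by (rule funpow_fixed)
  obtain k where "(shift_step h ^^ k) (replicate (Suc m) b) = replicate (Suc m) (\<not> b)"
    by (rule single_cycle_reach[OF assms, of "replicate (Suc m) b" "replicate (Suc m) (\<not> b)"]) auto
  then show False
    using fixed[of k] by simp
qed

lemma xor_adjacent_constant_iff:
  assumes "length w = Suc n"
  shows "xor_adjacent w = replicate n False \<longleftrightarrow> w = replicate (Suc n) False \<or> w = replicate (Suc n) True"
  using xor_adjacent_eq_cases[of w "replicate (Suc n) False"] assms
    xor_adjacent_replicate[of n False] xor_adjacent_replicate[of n True]
  by (auto simp del: replicate_Suc xor_adjacent.simps)

lemma complementary_cycles_step:
  assumes n: "n \<ge> 2"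
    and P: "single_cycle (shift_step h) {w. length w = n}"
    and Q: "single_cycle (shift_step (\<lambda>r. \<not> h r)) (nonconstant_words n)"
  shows "\<exists>h. single_cycle (shift_step h) {w. length w = Suc n} \<and>
             single_cycle (shift_step (\<lambda>r. \<not> h r)) (nonconstant_words (Suc n))"
proof -
  obtain m where m: "n = Suc m" "m \<ge> 1"
    using n by (cases n) auto
  have h1: "h (replicate m b)" for b
    using feedback_constant P m by simp
  \<comment> \<open>The two words with tail \<open>v\<close> project to 1...1 and 01...1, which lie
    in different cycles of the complementary register.\<close>
  define v where "v = alternating n True"
  define h' where "h' = (\<lambda>r. lift_feedback h r \<noteq> (r = v))"
  have len_v: "length v = n"
    by (simp add: v_def)
  have v0: "False # v = alternating (Suc n) False"
    by (simp add: v_def)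
  have xor0: "xor_adjacent (False # v) = replicate n True"
    unfolding v0 by (rule xor_adjacent_alternating)
  have xor1: "xor_adjacent (True # v) = False # replicate m True"
    using xor_adjacent_alternating[of m True] by (simp add: v_def m)

  interpret P: lifted_cycle h n "{w. length w = n}"
    using n P by unfold_locales auto
  have PT: "P.T = {w. length w = Suc n}"
    by (auto simp: P.T_def)
  define A where "A = {w. \<exists>k. (shift_step (lift_feedback h) ^^ k) (False # v) = w}"
  have ev: "even (card {v \<in> {w. length w = n}. hd v})"
    unfolding m card_hd_bool_lists using m by simp
  have "False # v \<in> P.T"
    by (simp add: PT len_v)
  note A = P.even_lift[OF ev this, folded A_def]
  have aA: "False # v \<in> A"
    unfolding A_def by (auto intro: exI[of _ 0])
  \<comment> \<open>The successor of 01...1 is 1...1 because \<open>h\<close> is 1 on constant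
    words. Its lift here starts with 1, so it is the alternating word opposite to
    \<open>False # v\<close>; this places \<open>True # v\<close> outside \<open>A\<close>.\<close>
  have Fv: "P.F (True # v) = map Not (False # v)"
  proof (rule xor_adjacent_inj)
    have "xor_adjacent (P.F (True # v)) = shift_step h (False # replicate m True)"
      using P.xor_F[of "True # v"] xor1 by (simp add: PT len_v)
    also have "\<dots> = replicate n True"
      using h1 by (simp add: shift_step_def m replicate_append_same)
    finally show "xor_adjacent (P.F (True # v)) = xor_adjacent (map Not (False # v))"
      unfolding xor_adjacent_map_Not xor0 .
    show "length (P.F (True # v)) = length (map Not (False # v))"
      by (simp add: length_shift_step)
    show "hd (P.F (True # v)) = hd (map Not (False # v))"
      by (simp add: shift_step_def v_def m)
  qed
  have bA: "True # v \<in> map Not ` A"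
  proof (rule ccontr)
    assume "True # v \<notin> map Not ` A"
    then have "True # v \<in> A"
      using A(4) by (auto simp: PT len_v)
    then have "map Not (False # v) \<in> A"
      using A(1) Fv unfolding single_cycle_def by (metis imageI subsetD)
    with aA A(3) show False
      by blast
  qed
  have "single_cycle (shift_step h') (A \<union> map Not ` A)"
  proof (rule single_cycle_join[OF A(1) aA A(2) bA A(3)])
    fix x assume "x \<in> A \<union> map Not ` A"
    then have "x \<noteq> []"
      unfolding A(4) PT by auto
    then show "shift_step h' x = P.F (transpose (False # v) (True # v) x)"
      unfolding h'_def by (rule shift_step_toggle)
  qed
  then have one: "single_cycle (shift_step h') {w. length w = Suc n}"
    unfolding A(4) PT .

  interpret Q: lifted_cycle "\<lambda>r. \<not> h r" n "nonconstant_words n"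
    using n Q by unfold_locales (auto simp: nonconstant_words_def)
  \<comment> \<open>The complementary register has a loop at 1...1; its only word starts with 1, so
    its lift is a single cycle.\<close>
  interpret L: lifted_cycle "\<lambda>r. \<not> h r" n "{replicate n True}"
    using n h1[of True]
    by unfold_locales (auto simp: single_cycle_def m shift_step_def replicate_append_same intro: exI[of _ 0])
  have "{v \<in> {replicate n True}. hd v} = {replicate n True}"
    by (auto simp: m)
  then have L: "single_cycle Q.F L.T"
    by (intro L.single_cycle_lift) simp
  have Q: "single_cycle Q.F Q.T"
    using n by (intro Q.single_cycle_lift odd_hd_nonconstant)
  have disj: "L.T \<inter> Q.T = {}"
    unfolding L.T_def Q.T_def unfolding nonconstant_words_def by auto
  have "single_cycle (shift_step (\<lambda>r. \<not> h' r)) (L.T \<union> Q.T)"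
  proof (rule single_cycle_join[OF L _ Q _ disj])
    show "False # v \<in> L.T"
      using xor0 by (simp add: L.T_def len_v)
    show "True # v \<in> Q.T"
      using xor1 m unfolding Q.T_def unfolding nonconstant_words_def
      by (auto simp: len_v Cons_replicate_eq)
    fix x assume "x \<in> L.T \<union> Q.T"
    then have x: "x \<noteq> []"
      by (auto simp: L.T_def Q.T_def)
    \<comment> \<open>Negation passes through both the toggle and the lift, so the same toggle acts
      on the complementary side.\<close>
    have "(\<lambda>r. \<not> h' r) = (\<lambda>r. lift_feedback (\<lambda>r. \<not> h r) r \<noteq> (r = v))"
      by (auto simp: h'_def lift_feedback_Not)
    then show "shift_step (\<lambda>r. \<not> h' r) x = Q.F (transpose (False # v) (True # v) x)"
      using shift_step_toggle[OF x] by simp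
  qed
  moreover have "xor_adjacent (replicate (Suc n) b) \<noteq> replicate n True" for b
    unfolding xor_adjacent_replicate by (simp add: m)
  \<comment> \<open>The projections covered miss only 0...0, whose two preimages are the constant
    words.\<close>
  then have "L.T \<union> Q.T = nonconstant_words (Suc n)"
    using xor_adjacent_constant_iff[of _ n]
    unfolding L.T_def Q.T_def unfolding nonconstant_words_def by (auto simp del: replicate_Suc)
  ultimately show ?thesis
    using one by auto
qed

text \<open>Feedback 1 complements the outgoing digit, giving the cycle 00, 01, 11, 10; feedback 0
  rotates, exchanging 01 and 10.\<close>

lemma complementary_cycles_base:
  "single_cycle (shift_step (\<lambda>_. True)) {w. length w = 2}"
  "single_cycle (shift_step (\<lambda>_. False)) (nonconstant_words 2)"
proof -
  have words: "{w :: bool list. length w = 2} = {[a, b] | a b. True}"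
    by (auto simp: numeral_2_eq_2 length_Suc_conv)
  have nonconst: "nonconstant_words 2 = {[a, \<not> a] | a. True}"
    unfolding nonconstant_words_def words by (auto simp: numeral_2_eq_2)
  have "\<exists>k. (shift_step (\<lambda>_. True) ^^ k) [a, b] = [c, d]" for a b c d
  proof -
    have "[c, d] \<in> {[a, b], [b, \<not> a], [\<not> a, \<not> b], [\<not> b, a]}"
      by auto
    moreover have "(shift_step (\<lambda>_. True) ^^ 0) [a, b] = [a, b]"
      "(shift_step (\<lambda>_. True) ^^ 1) [a, b] = [b, \<not> a]"
      "(shift_step (\<lambda>_. True) ^^ 2) [a, b] = [\<not> a, \<not> b]"
      "(shift_step (\<lambda>_. True) ^^ 3) [a, b] = [\<not> b, a]"
      by (auto simp: shift_step_def numeral_2_eq_2 numeral_3_eq_3)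
    ultimately show ?thesis
      by blast
  qed
  then show "single_cycle (shift_step (\<lambda>_. True)) {w. length w = 2}"
    unfolding words single_cycle_def by (auto simp: shift_step_def)
  have "\<exists>k. (shift_step (\<lambda>_. False) ^^ k) [a, \<not> a] = [c, \<not> c]" for a c
  proof -
    have "(shift_step (\<lambda>_. False) ^^ 0) [a, \<not> a] = [a, \<not> a]"
      "(shift_step (\<lambda>_. False) ^^ 1) [a, \<not> a] = [\<not> a, a]"
      by (auto simp: shift_step_def)
    then show ?thesis
      by (metis (full_types))
  qed
  then show "single_cycle (shift_step (\<lambda>_. False)) (nonconstant_words 2)"
    unfolding nonconst single_cycle_def by (auto simp: shift_step_def)
qed

lemma complementary_cycles:
  assumes "n \<ge> 2"
  shows "\<exists>h. single_cycle (shift_step h) {w. length w = n} \<and>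
             single_cycle (shift_step (\<lambda>r. \<not> h r)) (nonconstant_words n)"
  using assms
proof (induction n rule: nat_induct_at_least)
  case base
  then show ?case
    using complementary_cycles_base by (intro exI[of _ "\<lambda>_. True"]) simp
next
  case (Suc n)
  then show ?case
    using complementary_cycles_step by blast
qed


section \<open>Components of a permutation digraph\<close>

definition map_graph :: "('a \<Rightarrow> 'a) \<Rightarrow> 'a set \<Rightarrow> 'a pair_pre_digraph" where
  "map_graph g S = \<lparr>pverts = S, parcs = {(w, g w) | w. w \<in> S}\<rparr>"

lemma map_graph_simps [simp]:
  "pverts (map_graph g S) = S" "parcs (map_graph g S) = {(w, g w) | w. w \<in> S}"
  by (simp_all add: map_graph_def)

lemma wf_map_graph:
  assumes "g ` S \<subseteq> S" shows "wf_digraph (with_proj (map_graph g S))"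
  using assms by unfold_locales auto

lemma subgraph_map_graph:
  assumes "g ` S \<subseteq> S" "g ` V \<subseteq> V" "S \<subseteq> V"
  shows "subgraph (with_proj (map_graph g S)) (with_proj (map_graph g V))"
  using assms by (intro subgraphI wf_map_graph) auto

lemma connected_map_graph:
  assumes "S \<noteq> {}" "single_cycle g S"
  shows "connected (with_proj (map_graph g S))"
proof -
  let ?G = "with_proj (map_graph g S)"
  have gS: "g ` S \<subseteq> S"
    using assms by (simp add: single_cycle_def)
  interpret wf_digraph ?G
    using gS by (rule wf_map_graph)
  interpret M: pair_wf_digraph "mk_symmetric ?G"
    by (rule wellformed_mk_symmetric)
  have "u \<rightarrow>\<^sup>*\<^bsub>?G\<^esub> (g ^^ k) u" if "u \<in> S" for u k
  proof (induction k)
    case (Suc k)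
    have "(g ^^ k) u \<in> S"
      using gS that by (rule funpow_in_set)
    then have "(g ^^ k) u \<rightarrow>\<^bsub>?G\<^esub> g ((g ^^ k) u)"
      by simp
    with Suc show ?case
      by (simp add: reachable_adj_trans)
  qed (use that in auto)
  then have "u \<rightarrow>\<^sup>*\<^bsub>mk_symmetric ?G\<^esub> w" if "u \<in> S" "w \<in> S" for u w
    using that assms by (metis reachable_mk_symmetricI single_cycle_reach)
  then show ?thesis
    unfolding connected_def using assms(1) by (intro strongly_connectedI) auto
qed

lemma subgraph_antisym:
  assumes "subgraph G H" "subgraph H G" shows "G = H"
  using assms by (auto simp: subgraph_def compatible_def intro!: pre_digraph.equality)

text \<open>No arc joins different members of \<open>P\<close>, so an undirected walk in
  \<open>H\<close> stays in the member where it starts.\<close>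

lemma connected_subgraph_map_graph:
  assumes H: "subgraph H (with_proj (map_graph g (\<Union>P)))" "connected H"
    and P: "\<And>S. S \<in> P \<Longrightarrow> g ` S \<subseteq> S" "pairwise disjnt P"
  obtains S where "S \<in> P" "subgraph H (with_proj (map_graph g S))"
proof -
  have tl: "tail H = fst" "head H = snd" "verts H \<subseteq> \<Union>P" "arcs H \<subseteq> {(w, g w) | w. w \<in> \<Union>P}"
    and wf: "wf_digraph H"
    using H(1) by (auto simp: subgraph_def compatible_def)
  interpret wf_digraph H by (rule wf)
  interpret M: pair_wf_digraph "mk_symmetric H"
    by (rule wellformed_mk_symmetric)
  have sc: "strongly_connected (with_proj (mk_symmetric H))"
    using H(2) by (simp add: connected_def)
  then obtain u where u: "u \<in> verts H"
    by (auto simp: strongly_connected_def)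
  then obtain S where S: "S \<in> P" "u \<in> S"
    using tl by auto
  have closed: "S' = S" if "S' \<in> P" "x \<in> S'" "x \<in> S" for S' x
    using that S P(2) by (metis disjnt_iff pairwiseD)
  \<comment> \<open>The forward implication serves arcs traversed backwards: the member containing
    \<open>w\<close> also contains \<open>g w\<close>, hence is \<open>S\<close>.\<close>
  have edge: "g w \<in> S \<longleftrightarrow> w \<in> S" if "w \<in> \<Union>P" for w
    using that closed P(1) S(1) by blast
  have "w \<in> S" if "w \<in> verts H" for w
  proof -
    have "u \<rightarrow>\<^sup>*\<^bsub>mk_symmetric H\<^esub> w"
      using sc u that by (auto simp: strongly_connected_def)
    then show ?thesis
    proof (induction rule: M.reachable_induct)
      case (step x y)
      then have "(x, y) \<in> parcs (mk_symmetric H)"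
        by simp
      then obtain e where "e \<in> arcs H" "(x, y) = e \<or> (y, x) = e"
        by (auto simp: parcs_mk_symmetric tl)
      then show ?case
        using step.IH tl(4) edge by blast
    qed (rule S)
  qed
  then have "verts H \<subseteq> S"
    by auto
  moreover from this have "arcs H \<subseteq> {(w, g w) | w. w \<in> S}"
    using tl wellformed(1) by fastforce
  ultimately have "subgraph H (with_proj (map_graph g S))"
    using wf tl S P by (intro subgraphI wf_map_graph) (auto simp: compatible_def)
  with S show thesis
    by (blast intro: that)
qed

text \<open>Each cycle is connected and every connected subgraph fits into one cycle, so the maximal
  ones are the cycles.\<close>

lemma components_map_graph:
  assumes cyc: "\<And>S. S \<in> P \<Longrightarrow> single_cycle g S" and ne: "{} \<notin> P" and disj: "pairwise disjnt P"
  shows "components (with_proj (map_graph g (\<Union>P))) = (\<lambda>S. with_proj (map_graph g S)) ` P"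
proof -
  let ?G = "with_proj (map_graph g (\<Union>P))"
  have gS: "g ` S \<subseteq> S" if "S \<in> P" for S
    using cyc[OF that] by (simp add: single_cycle_def)
  have sub: "subgraph (with_proj (map_graph g S)) ?G" if "S \<in> P" for S
    using that gS by (intro subgraph_map_graph) blast+
  have conn: "connected (with_proj (map_graph g S))" if "S \<in> P" for S
    using that ne cyc by (intro connected_map_graph) auto
  show ?thesis
  proof (intro equalityI subsetI)
    fix H assume "H \<in> components ?G"
    then have H: "subgraph H ?G" "connected H"
      "\<And>H'. H' \<noteq> H \<Longrightarrow> subgraph H H' \<Longrightarrow> subgraph H' ?G \<Longrightarrow> \<not> connected H'"
      by (auto simp: components_def pre_digraph.max_subgraph_def)
    from H(1,2) gS disj obtain S where S: "S \<in> P" "subgraph H (with_proj (map_graph g S))"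
      by (rule connected_subgraph_map_graph)
    then have "with_proj (map_graph g S) = H"
      using H(3)[OF _ S(2) sub[OF S(1)]] conn[OF S(1)] by blast
    with S(1) show "H \<in> (\<lambda>S. with_proj (map_graph g S)) ` P"
      by blast
  next
    fix H assume "H \<in> (\<lambda>S. with_proj (map_graph g S)) ` P"
    then obtain S where S: "S \<in> P" "H = with_proj (map_graph g S)"
      by blast
    have "H' = H" if "subgraph H H'" "subgraph H' ?G" "connected H'" for H'
    proof -
      from that(2,3) gS disj obtain S' where S': "S' \<in> P" "subgraph H' (with_proj (map_graph g S'))"
        by (rule connected_subgraph_map_graph)
      then have "S \<subseteq> S'"
        using subgraph_imp_subverts[OF that(1)] subgraph_imp_subverts[OF S'(2)] S(2) by simp
      then have "S = S'"
        using S S' ne disj by (metis disjnt_iff pairwiseD subsetD ex_in_conv)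
      then show "H' = H"
        using S'(2) S(2) that(1) subgraph_antisym by blast
    qed
    then show "H \<in> components ?G"
      using S sub conn by (auto simp: components_def pre_digraph.max_subgraph_def)
  qed
qed


section \<open>From the cycles to a double helix\<close>

lemma nth_eq_hd_shift_step:
  "j < length w \<Longrightarrow> w ! j = hd ((shift_step h ^^ j) w)"
proof (induction j arbitrary: w)
  case 0
  then show ?case by (simp add: hd_conv_nth)
next
  case (Suc j)
  have "w ! Suc j = shift_step h w ! j"
    using Suc.prems by (cases w) (auto simp: shift_step_def nth_append)
  then show ?case
    using Suc.IH[of "shift_step h w"] Suc.prems length_shift_step[of w h]
    by (cases w) (auto simp: funpow_swap1)
qed

text \<open>The heads of \<open>n\<close> consecutive states spell the first of them, and
  \<open>N + n - 1\<close> digits have exactly \<open>N\<close> windows.\<close>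

lemma windows_shift_sequence:
  assumes u: "length u = n" and n: "n \<ge> 1"
  shows "windows n (map (\<lambda>i. hd ((shift_step h ^^ i) u)) [0..<N + n - 1])
    = map (\<lambda>i. (shift_step h ^^ i) u) [0..<N]"
proof -
  let ?f = "shift_step h"
  have len: "length ((?f ^^ i) u) = n" for i
    using u n by (induction i) (auto simp: shift_step_def)
  have "take n (drop i (map (\<lambda>i. hd ((?f ^^ i) u)) [0..<N + n - 1])) = (?f ^^ i) u" if "i < N" for i
  proof (rule nth_equalityI)
    fix j assume "j < length (take n (drop i (map (\<lambda>i. hd ((?f ^^ i) u)) [0..<N + n - 1])))"
    then have "j < n" "i + j < N + n - 1"
      by auto
    moreover have "hd ((?f ^^ (i + j)) u) = (?f ^^ i) u ! j" if "j < n"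
      using nth_eq_hd_shift_step[of j "(?f ^^ i) u" h] that len
      by (simp add: funpow_add add.commute[of i])
    ultimately show "take n (drop i (map (\<lambda>i. hd ((?f ^^ i) u)) [0..<N + n - 1])) ! j = (?f ^^ i) u ! j"
      by simp
  qed (use that len n in auto)
  moreover have "Suc (N + n - 1) - n = N"
    using n by simp
  ultimately show ?thesis
    unfolding windows_def by auto
qed

lemma sublist_iff_window:
  assumes "length w = n"
  shows "sublist w X \<longleftrightarrow> w \<in> set (windows n X)"
proof
  assume "sublist w X"
  then obtain p s where "X = p @ w @ s"
    by (auto simp: sublist_def)
  with assms show "w \<in> set (windows n X)"
    by (auto simp: windows_def intro!: image_eqI[of _ _ "length p"])
next
  assume "w \<in> set (windows n X)"
  then obtain i where "w = take n (drop i X)"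
    by (auto simp: windows_def)
  then show "sublist w X"
    by (metis sublist_drop sublist_order.order.trans sublist_take)
qed

text \<open>Any competitor needs \<open>2 ^ n\<close> distinct windows, hence as many starting
  positions.\<close>

lemma de_bruijn_stringI:
  assumes set: "set (windows n X) = {w. length w = n}" and len: "length X = 2 ^ n + n - 1"
  shows "de_bruijn_string n X"
proof -
  have "length Y \<ge> length X" if "contains_all_strings n Y" for Y
  proof -
    have "{w. length w = n} \<subseteq> set (windows n Y)"
      using that sublist_iff_window by (auto simp: contains_all_strings_def)
    then have "2 ^ n \<le> card (set (windows n Y))"
      using card_mono[OF finite_set] card_bool_lists by metis
    also have "\<dots> \<le> Suc (length Y) - n"
      using card_length[of "windows n Y"] by (simp add: windows_def)
    finally have "2 ^ n \<le> Suc (length Y) - n" .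
    \<comment> \<open>Positivity excludes the case where the subtraction is truncated to 0.\<close>
    moreover have "(2::nat) ^ n > 0"
      by simp
    ultimately show ?thesis
      using len by linarith
  qed
  moreover have "contains_all_strings n X"
    using set sublist_iff_window by (auto simp: contains_all_strings_def)
  ultimately show ?thesis
    by (auto simp: de_bruijn_string_def is_arg_min_linorder)
qed

text \<open>Rotation moves \<open>u\<close> to the end, where it is the successor of the last
  iterate.\<close>

lemma zip_rotate1_funpow:
  assumes "N > 0" "(f ^^ N) u = u"
  shows "set (zip (map (\<lambda>i. (f ^^ i) u) [0..<N]) (rotate1 (map (\<lambda>i. (f ^^ i) u) [0..<N])))
    = (\<lambda>w. (w, f w)) ` (\<lambda>i. (f ^^ i) u) ` {..<N}"
proof -
  obtain M where N: "N = Suc M"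
    using assms(1) by (cases N) auto
  have "rotate1 (map (\<lambda>i. (f ^^ i) u) [0..<N]) = map (\<lambda>i. (f ^^ Suc i) u) [0..<N]"
  proof -
    have "[0..<N] = 0 # map Suc [0..<M]"
      unfolding N by (simp add: upt_conv_Cons map_Suc_upt del: upt_Suc)
    then have "rotate1 (map (\<lambda>i. (f ^^ i) u) [0..<N]) = map (\<lambda>i. (f ^^ Suc i) u) [0..<M] @ [u]"
      by simp
    also have "\<dots> = map (\<lambda>i. (f ^^ Suc i) u) [0..<N]"
      using assms(2) by (simp add: N)
    finally show ?thesis .
  qed
  then show ?thesis
    by (auto simp: zip_map_map zip_same_conv_map image_iff)
qed

text \<open>Each vertex has two outgoing arcs, differing in the appended digit; negating the
  feedback selects the one off the circuit.\<close>

lemma remaining_graph_shift_step: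
  assumes n: "n \<ge> 1" and arcs: "circuit_arcs n X = (\<lambda>w. (w, shift_step h w)) ` {w. length w = n}"
  shows "remaining_graph n X = map_graph (shift_step (\<lambda>r. \<not> h r)) {w. length w = n}"
proof -
  have "{(x # r, r @ [y]) | x r y. Suc (length r) = n} - (\<lambda>w. (w, shift_step h w)) ` {w. length w = n}
     = {(w, shift_step (\<lambda>r. \<not> h r) w) | w. length w = n}" (is "?L = ?R")
  proof (intro equalityI subsetI)
    fix e assume "e \<in> ?L"
    then obtain x r y where e: "e = (x # r, r @ [y])" "Suc (length r) = n"
      by auto
    with \<open>e \<in> ?L\<close> have "r @ [y] \<noteq> shift_step h (x # r)"
      by (auto simp: image_iff)
    then have "y = (x \<noteq> (\<not> h r))"
      by (auto simp: shift_step_def)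
    with e show "e \<in> ?R"
      by (auto simp: shift_step_def intro!: exI[of _ "x # r"])
  next
    fix e assume "e \<in> ?R"
    then obtain w where w: "e = (w, shift_step (\<lambda>r. \<not> h r) w)" "length w = n"
      by auto
    then obtain x r where "w = x # r"
      using n by (cases w) auto
    with w show "e \<in> ?L"
      by (auto simp: shift_step_def)
  qed
  then show ?thesis
    unfolding remaining_graph_def map_graph_def arcs de_bruijn_graph_def by simp
qed

text \<open>\<open>X\<close> records the heads along the cycle from 0...0, one per vertex and
  \<open>n - 1\<close> more to complete the last windows.\<close>

lemma double_helixI:
  assumes n: "n \<ge> 2" and P: "single_cycle (shift_step h) {w. length w = n}"
    and Q: "single_cycle (shift_step (\<lambda>r. \<not> h r)) (nonconstant_words n)"
  defines "X \<equiv> map (\<lambda>i. hd ((shift_step h ^^ i) (replicate n False))) [0..<2 ^ n + n - 1]"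
  shows "double_helix n X"
proof -
  let ?W = "{w :: bool list. length w = n}" and ?g = "shift_step (\<lambda>r. \<not> h r)"
  let ?u = "replicate n False"
  have u: "?u \<in> ?W" by simp
  note per = single_cycle_period[OF P u, unfolded card_bool_lists]
  have im: "(\<lambda>i. (shift_step h ^^ i) ?u) ` {..<2 ^ n} = ?W"
    using per(1) by (simp add: bij_betw_def)
  have win: "windows n X = map (\<lambda>i. (shift_step h ^^ i) ?u) [0..<2 ^ n]"
    unfolding X_def using n by (intro windows_shift_sequence) auto
  have db: "de_bruijn_string n X"
    using im by (intro de_bruijn_stringI) (auto simp: win atLeast0LessThan, simp add: X_def)
  have "circuit_arcs n X = (\<lambda>w. (w, shift_step h w)) ` ?W"
    unfolding circuit_arcs_def win using zip_rotate1_funpow[OF _ per(2)] im by simp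
  then have rem: "remaining_graph n X = map_graph ?g ?W"
    using n by (intro remaining_graph_shift_step) auto

  let ?c = "\<lambda>b. {replicate n b}"
  obtain m where m: "n = Suc m" "m \<ge> 1"
    using n by (cases n) auto
  \<comment> \<open>The complementary feedback is 0 on constant words, so both loops
    survive.\<close>
  have fixed: "?g (replicate n b) = replicate n b" for b
    using feedback_constant[of h m b] P m
    by (simp add: shift_step_def replicate_append_same)
  define C where "C = {?c False, ?c True, nonconstant_words n}"
  have UC: "\<Union>C = ?W"
    by (auto simp: C_def nonconstant_words_def)
  have alt: "alternating n True \<in> nonconstant_words n"
  proof -
    obtain k where "n = Suc (Suc k)"
      using m by (cases m) auto
    then show ?thesis
      by (simp add: nonconstant_words_def)
  qed
  have "replicate n b \<notin> nonconstant_words n" for b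
    by (cases b) (auto simp: nonconstant_words_def)
  then have distinct: "?c False \<noteq> ?c True" "?c b \<noteq> nonconstant_words n" for b
    using m by (simp, metis insertI1)
  have "components (with_proj (map_graph ?g (\<Union>C))) = (\<lambda>S. with_proj (map_graph ?g S)) ` C"
  proof (rule components_map_graph)
    show "single_cycle ?g S" if "S \<in> C" for S
      using that Q fixed by (auto simp: C_def single_cycle_def intro: exI[of _ 0])
    show "{} \<notin> C"
      using alt by (auto simp: C_def)
    show "pairwise disjnt C"
      using m by (auto simp: C_def pairwise_def disjnt_def nonconstant_words_def)
  qed
  then have comp: "components (with_proj (remaining_graph n X)) = (\<lambda>S. with_proj (map_graph ?g S)) ` C"
    by (simp add: rem UC)
  \<comment> \<open>A component determines its vertex set, so the three sets in \<open>C\<close>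
    give three components.\<close>
  have "inj_on (\<lambda>S. with_proj (map_graph ?g S)) C"
    by (rule inj_onI) (metis map_graph_simps(1) with_proj_simps(1))
  then have "card (components (with_proj (remaining_graph n X))) = card C"
    unfolding comp by (rule card_image)
  also have "card C = 3"
    unfolding C_def using distinct by simp
  finally have "card (components (with_proj (remaining_graph n X))) = 3" .
  moreover have "loop_graph (replicate n b) = map_graph ?g (?c b)" for b
    using fixed by (simp add: loop_graph_def map_graph_def)
  ultimately show ?thesis
    using db by (simp add: double_helix_def comp C_def)
qed

theorem mainTheorem6:
  fixes n :: nat
  assumes "n \<ge> 2"
  shows "\<exists>X. double_helix n X"
  using complementary_cycles[OF assms] double_helixI[OF assms] by blast

end
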